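(* For every integer $n\ge 2$ let $(G^2_n,\boldsymbol c^2_n)$ be the EWMCP instance and $\mathscr C^2_n$ the coloring of $G^2_n$ defined in the context, and let $\prec^2_n$ be any total order of the independent sets in $\mathscr C^2_n$. Then $$\frac{\mathrm{UB}_2(G^2_n,\boldsymbol c^2_n,\mathscr C^2_n,\prec^2_n)}{\mathrm{UB}_1(G^2_n,\boldsymbol c^2_n,\mathscr C^2_n)}\to+\infty\quad\text{as } n\to+\infty .$$
   Context: An instance of the Edge-Weighted Maximum Clique Problem (EWMCP) is a pair $(G,\boldsymbol c)$ where $G=(V,E)$ is a finite simple undirected graph and $\boldsymbol c=(c_e)_{e\in E}$ is a vector of nonnegative integer edge-weights. For $u\in V$, $\delta(u)\subseteq E$ is the set of edges incident to $u$. A clique is a set of pairwise adjacent vertices. A coloring $\mathscr C$ of the vertices of $G$ is a partition of $V$ into disjoint non-empty independent sets (sets of pairwise non-adjacent vertices). First upper bound. $\mathrm{UB}_1(G,\boldsymbol c,\mathscr C)$ is the optimal value of the linear program, in real variables $\pi_I$ ($I\in\mathscr C$) and $\varrho_{eu},\varrho_{ev}$ (for each edge $e=\{u,v\}\in E$), $$\min \sum_{I\in\mathscr C}\pi_I$$ subject to $\varrho_{eu}+\varrho_{ev}=c_e$ for every $e=\{u,v\}\in E$; $\pi_I\ge\sum_{e\in\delta(u)}\varrho_{eu}$ for every $I\in\mathscr C$ and $u\in I$; and $\pi_I\ge0$, $\varrho_{eu}\ge0$, $\varrho_{ev}\ge0$ for all $I\in\mathscr C$ and all $e=\{u,v\}\in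 E$. Second upper bound. Let $\prec$ be a (strict) total order on the coloring $\mathscr C$, and let $I(u)\in\mathscr C$ denote the unique member of $\mathscr C$ containing $u\in V$. For $u\in V$ set $$\sigma_u:=\sum_{I\in\mathscr C:\,I\prec I(u)}\max\{c_e: e=\{u,v\}\in\delta(u),\ v\in I\},$$ where the maximum is $0$ if no such edge exists. Then $$\mathrm{UB}_2(G,\boldsymbol c,\mathscr C,\prec):=\sum_{I\in\mathscr C}\max\{\sigma_u:u\in I\}.$$ The instances. For every integer $n\ge2$, the vertex set of $G^2_n$ is the disjoint union of a set $C_0$ of $n$ vertices and, for each $u\in C_0$, a set $C_u$ of $n-1$ vertices (the sets $C_0$ and $C_u$, $u\in C_0$, are pairwise disjoint). The edges are exactly those making $C_0$ a clique and $C_u\cup\{u\}$ a clique for every $u\in C_0$. Edges $\{u,v\}$ with $u\in C_0$ and $v\in C_u$ have weight $1$; all other edges have weight $0$. These weights define $\boldsymbol c^2_n$. The coloring. $\mathscr C^2_n=\{I_u:u\in C_0\}$ is a partition of the vertex set into $n$ independent sets, where each $I_u$ consists of the vertex $u$ together with exactly one vertex of $C_v$ for every $v\in C_0$, $v\ne u$, chosen so that each vertex of $C_v$ lies in exactly one of the sets $I_u$ with $u\ne v$. *)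

theory Defs
  imports Complex_Main "HOL-Library.Disjoint_Sets"
begin

section \<open>Edge-weighted graphs and colorings\<close>

text \<open>A graph is a pair of a vertex set and an edge set; an edge is the two-element set of its
  endpoints. Edge weights are natural numbers; only their values on edges matter.\<close>

type_synonym 'a graph = "'a set \<times> 'a set set"

abbreviation verts :: "'a graph \<Rightarrow> 'a set" where "verts \<equiv> fst"
abbreviation edges :: "'a graph \<Rightarrow> 'a set set" where "edges \<equiv> snd"

definition simple_graph :: "'a graph \<Rightarrow> bool" where
  "simple_graph G \<longleftrightarrow> finite (verts G) \<and>
     (\<forall>e\<in>edges G. \<exists>u\<in>verts G. \<exists>v\<in>verts G. u \<noteq> v \<and> e = {u, v})"

definition incident_edges :: "'a graph \<Rightarrow> 'a \<Rightarrow> 'a set set" where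
  "incident_edges G u = {e \<in> edges G. u \<in> e}"

definition independent_set :: "'a graph \<Rightarrow> 'a set \<Rightarrow> bool" where
  "independent_set G I \<longleftrightarrow> I \<subseteq> verts G \<and> (\<forall>u\<in>I. \<forall>v\<in>I. {u, v} \<notin> edges G)"

definition coloring :: "'a graph \<Rightarrow> 'a set set \<Rightarrow> bool" where
  "coloring G \<C> \<longleftrightarrow> partition_on (verts G) \<C> \<and> (\<forall>I\<in>\<C>. independent_set G I)"

section \<open>First upper bound\<close>

definition UB1_feasible ::
  "'a graph \<Rightarrow> ('a set \<Rightarrow> nat) \<Rightarrow> 'a set set \<Rightarrow> ('a set \<Rightarrow> real) \<Rightarrow> ('a set \<Rightarrow> 'a \<Rightarrow> real) \<Rightarrow> bool" where
  "UB1_feasible G c \<C> \<pi> \<rho> \<longleftrightarrow>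
     (\<forall>u v. {u, v} \<in> edges G \<longrightarrow> \<rho> {u, v} u + \<rho> {u, v} v = real (c {u, v})) \<and>
     (\<forall>I\<in>\<C>. \<forall>u\<in>I. \<pi> I \<ge> (\<Sum>e\<in>incident_edges G u. \<rho> e u)) \<and>
     (\<forall>I\<in>\<C>. \<pi> I \<ge> 0) \<and>
     (\<forall>e\<in>edges G. \<forall>u\<in>e. \<rho> e u \<ge> 0)"

definition UB1 :: "'a graph \<Rightarrow> ('a set \<Rightarrow> nat) \<Rightarrow> 'a set set \<Rightarrow> real" where
  "UB1 G c \<C> = Inf {(\<Sum>I\<in>\<C>. \<pi> I) | \<pi> \<rho>. UB1_feasible G c \<C> \<pi> \<rho>}"

text \<open>The infimum is over a nonempty set of reals that is bounded below.\<close>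

lemma UB1_values_nonempty_bdd_below:
  assumes G: "simple_graph G"
  shows "{(\<Sum>I\<in>\<C>. \<pi> I) | \<pi> \<rho>. UB1_feasible G c \<C> \<pi> \<rho>} \<noteq> {}"
    and "bdd_below {(\<Sum>I\<in>\<C>. \<pi> I) | \<pi> \<rho>. UB1_feasible G c \<C> \<pi> \<rho>}"
proof -
  have "edges G \<subseteq> Pow (verts G)" "finite (verts G)"
    using G unfolding simple_graph_def by fastforce+
  then have fin: "finite (edges G)"
    by (meson finite_Pow_iff finite_subset)
  have "(\<Sum>e\<in>incident_edges G u. real (c e) / 2) \<le> (\<Sum>e\<in>edges G. real (c e))" for u
  proof -
    have "(\<Sum>e\<in>incident_edges G u. real (c e) / 2) \<le> (\<Sum>e\<in>incident_edges G u. real (c e))"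
      by (intro sum_mono) simp
    also have "\<dots> \<le> (\<Sum>e\<in>edges G. real (c e))"
      by (intro sum_mono2 fin) (auto simp: incident_edges_def)
    finally show ?thesis .
  qed
  then have "UB1_feasible G c \<C> (\<lambda>_. \<Sum>e\<in>edges G. real (c e)) (\<lambda>e _. real (c e) / 2)"
    unfolding UB1_feasible_def by (auto intro: sum_nonneg)
  then show "{(\<Sum>I\<in>\<C>. \<pi> I) | \<pi> \<rho>. UB1_feasible G c \<C> \<pi> \<rho>} \<noteq> {}" by blast
  show "bdd_below {(\<Sum>I\<in>\<C>. \<pi> I) | \<pi> \<rho>. UB1_feasible G c \<C> \<pi> \<rho>}"
    by (rule bdd_belowI[of _ 0]) (auto simp: UB1_feasible_def intro: sum_nonneg)
qed

section \<open>Second upper bound\<close>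

definition strict_total_order_on :: "'a set \<Rightarrow> ('a \<Rightarrow> 'a \<Rightarrow> bool) \<Rightarrow> bool" where
  "strict_total_order_on A R \<longleftrightarrow> irreflp_on A R \<and> transp_on A R \<and> totalp_on A R"

definition color_of :: "'a set set \<Rightarrow> 'a \<Rightarrow> 'a set" where
  "color_of \<C> u = (THE I. I \<in> \<C> \<and> u \<in> I)"

text \<open>Inserting \<open>0\<close> realises the convention that the maximum is \<open>0\<close> when there is no edge;
  as the weights are natural numbers, it has no effect otherwise.\<close>

definition sigma ::
  "'a graph \<Rightarrow> ('a set \<Rightarrow> nat) \<Rightarrow> 'a set set \<Rightarrow> ('a set \<Rightarrow> 'a set \<Rightarrow> bool) \<Rightarrow> 'a \<Rightarrow> nat" where
  "sigma G c \<C> prec u =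
     (\<Sum>I | I \<in> \<C> \<and> prec I (color_of \<C> u).
        Max (insert 0 {c {u, v} | v. {u, v} \<in> incident_edges G u \<and> v \<in> I}))"

definition UB2 ::
  "'a graph \<Rightarrow> ('a set \<Rightarrow> nat) \<Rightarrow> 'a set set \<Rightarrow> ('a set \<Rightarrow> 'a set \<Rightarrow> bool) \<Rightarrow> nat" where
  "UB2 G c \<C> prec = (\<Sum>I\<in>\<C>. Max (sigma G c \<C> prec ` I))"

section \<open>The instances\<close>

text \<open>\<open>Hub i\<close>, for \<open>i < n\<close>, are the vertices of the central clique;
  \<open>Leaf i k\<close>, for \<open>k < n - 1\<close>, are the vertices of the set attached to \<open>Hub i\<close>.\<close>

datatype vertex = Hub nat | Leaf nat nat

definition C0 :: "nat \<Rightarrow> vertex set" where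
  "C0 n = Hub ` {..<n}"

definition CL :: "nat \<Rightarrow> nat \<Rightarrow> vertex set" where
  "CL n i = Leaf i ` {..<n - 1}"

definition G2 :: "nat \<Rightarrow> vertex graph" where
  "G2 n =
     (C0 n \<union> (\<Union>i<n. CL n i),
      {{x, y} | x y. x \<noteq> y \<and>
         (x \<in> C0 n \<and> y \<in> C0 n \<or>
          (\<exists>i<n. x \<in> insert (Hub i) (CL n i) \<and> y \<in> insert (Hub i) (CL n i)))})"

definition c2 :: "nat \<Rightarrow> vertex set \<Rightarrow> nat" where
  "c2 n e = (if \<exists>i<n. \<exists>v\<in>CL n i. e = {Hub i, v} then 1 else 0)"

text \<open>Below, \<open>I i\<close> is the color class of \<open>Hub i\<close>.\<close>

definition coloring2 :: "nat \<Rightarrow> vertex set set \<Rightarrow> bool" where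
  "coloring2 n \<C> \<longleftrightarrow> coloring (G2 n) \<C> \<and>
     (\<exists>I. \<C> = I ` {..<n} \<and>
        (\<forall>i<n. I i \<inter> C0 n = {Hub i} \<and> I i \<inter> CL n i = {} \<and>
           (\<forall>j<n. j \<noteq> i \<longrightarrow> card (I i \<inter> CL n j) = 1)) \<and>
        (\<forall>j<n. \<forall>v\<in>CL n j. \<exists>!i. i < n \<and> i \<noteq> j \<and> v \<in> I i))"

lemma simple_graph_G2: "simple_graph (G2 n)"
  unfolding simple_graph_def G2_def C0_def CL_def by auto blast+

lemma edge_G2_iff:
  "{x, y} \<in> edges (G2 n) \<longleftrightarrow> x \<noteq> y \<and>
     (x \<in> C0 n \<and> y \<in> C0 n \<or>
      (\<exists>i<n. x \<in> insert (Hub i) (CL n i) \<and> y \<in> insert (Hub i) (CL n i)))"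
  unfolding G2_def by (auto simp: doubleton_eq_iff)

lemma coloring2_exists:
  "\<exists>\<C>. coloring2 n \<C>"
proof -
  define I where
    "I i = insert (Hub i) {Leaf j (if i < j then i else i - 1) | j. j < n \<and> j \<noteq> i}" for i
  have Int_C0: "I i \<inter> C0 n = {Hub i}" and Int_CL_self: "I i \<inter> CL n i = {}" if "i < n" for i
    using that by (auto simp: I_def C0_def CL_def)
  have Int_CL: "I i \<inter> CL n j = {Leaf j (if i < j then i else i - 1)}"
    if "i < n" "j < n" "j \<noteq> i" for i j
    using that by (auto simp: I_def CL_def)
  have ex1: "\<exists>!i. i < n \<and> i \<noteq> j \<and> v \<in> I i" if "j < n" "v \<in> CL n j" for j v
  proof -
    obtain k where k: "v = Leaf j k" "k < n - 1" using \<open>v \<in> CL n j\<close> by (auto simp: CL_def)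
    show ?thesis
    proof (rule ex1I[of _ "if k < j then k else Suc k"])
      show "(if k < j then k else Suc k) < n \<and> (if k < j then k else Suc k) \<noteq> j \<and>
          v \<in> I (if k < j then k else Suc k)"
        using k \<open>j < n\<close> by (auto simp: I_def)
    next
      fix i assume "i < n \<and> i \<noteq> j \<and> v \<in> I i"
      then show "i = (if k < j then k else Suc k)"
        using k by (auto simp: I_def split: if_splits)
    qed
  qed
  have sub: "I i \<subseteq> verts (G2 n)" if "i < n" for i
  proof
    fix v assume v: "v \<in> I i"
    show "v \<in> verts (G2 n)"
    proof (cases "v = Hub i")
      case True then show ?thesis using that by (auto simp: G2_def C0_def)
    next
      case False
      then obtain j where "j < n" "j \<noteq> i" "v = Leaf j (if i < j then i else i - 1)"
        using v by (auto simp: I_def)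
      then have "v \<in> CL n j" using that by (auto simp: CL_def)
      then show ?thesis using \<open>j < n\<close> by (auto simp: G2_def)
    qed
  qed
  have cover: "verts (G2 n) \<subseteq> (\<Union>i<n. I i)"
  proof
    fix v assume "v \<in> verts (G2 n)"
    then consider "v \<in> C0 n" | j where "j < n" "v \<in> CL n j" by (auto simp: G2_def)
    then show "v \<in> (\<Union>i<n. I i)"
    proof cases
      case 1 then show ?thesis by (auto simp: I_def C0_def)
    next
      case 2 then show ?thesis using ex1[of j v] by blast
    qed
  qed
  have disj: "I i \<inter> I i' = {}" if "i < n" "i' < n" "i \<noteq> i'" for i i'
  proof (rule ccontr)
    assume "I i \<inter> I i' \<noteq> {}"
    then obtain v where v: "v \<in> I i" "v \<in> I i'" by blast
    then show False using \<open>i \<noteq> i'\<close> by (auto simp: I_def split: if_splits)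
  qed
  have "partition_on (verts (G2 n)) (I ` {..<n})"
  proof (rule partition_onI)
    show "\<Union> (I ` {..<n}) = verts (G2 n)" using sub cover by blast
    show "disjnt p q" if "p \<in> I ` {..<n}" "q \<in> I ` {..<n}" "p \<noteq> q" for p q
      using that disj unfolding disjnt_def by blast
    show "{} \<notin> I ` {..<n}" by (auto simp: I_def)
  qed
  moreover have "independent_set (G2 n) (I i)" if "i < n" for i
    unfolding independent_set_def edge_G2_iff
    using that sub[OF that] by (auto simp: I_def C0_def CL_def)
  ultimately have "coloring (G2 n) (I ` {..<n})"
    by (auto simp: coloring_def)
  then have "coloring2 n (I ` {..<n})"
    unfolding coloring2_def using Int_C0 Int_CL_self Int_CL ex1
    by (intro conjI exI[of _ I]) auto
  then show ?thesis by blast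
qed

end

theory Submission
  imports Defs
begin

text \<open>
  The quotient of the two bounds is at least \<open>(n - 1) / 2\<close>, because the first is at most \<open>n\<close> and the
  second at least \<open>n (n - 1) / 2\<close>.

  The first bound may split the unit weight of an edge between a hub and one of its leaves freely.
  Charge all of it to the leaf. Every leaf lies on exactly one edge of positive weight, so all vertex
  loads become at most \<open>1\<close>, and each of the \<open>n\<close> color classes costs at most \<open>1\<close> (\<open>UB1_le\<close>).

  The second bound has no such freedom: an edge counts at its endpoint in the later class. Every
  class other than that of a given hub contains a leaf of this hub, so the hub collects weight \<open>1\<close>
  from each class that precedes its own (\<open>sigma_hub\<close>). Any two classes are comparable, whatever the
  order is, so summing over the hubs counts each of the \<open>n (n - 1) / 2\<close> pairs of classes
  (\<open>UB2_ge\<close>).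

  The passage to the quotient needs the first bound to be positive, as dividing by \<open>0\<close> would give \<open>0\<close>.
  It is, since it is at least the weight of any single edge (\<open>edge_weight_le_UB1\<close>).
\<close>

section \<open>General facts on colorings and total relations\<close>

lemma color_of_eq:
  assumes "coloring G \<C>" "I \<in> \<C>" "u \<in> I"
  shows "color_of \<C> u = I"
proof -
  have "disjoint \<C>"
    using assms(1) by (auto simp: coloring_def dest: partition_onD2)
  then show ?thesis
    unfolding color_of_def using assms(2,3)
    by (intro the_equality) (auto dest: disjointD)
qed

lemma finite_incident_edges:
  assumes "simple_graph G"
  shows "finite (incident_edges G u)"
proof -
  have "incident_edges G u \<subseteq> Pow (verts G)"
    using assms unfolding simple_graph_def incident_edges_def by fastforce
  moreover have "finite (verts G)"
    using assms by (simp add: simple_graph_def)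
  ultimately show ?thesis
    by (meson finite_Pow_iff finite_subset)
qed

text \<open>Every ordered pair of distinct elements is related in the given or in the reversed order, so
  the relation and its converse together cover the square of \<open>A\<close> without its diagonal.\<close>

lemma totalp_on_sum_card_predecessors_ge:
  assumes fin: "finite A" and tot: "totalp_on A R"
  shows "card A * (card A - 1) \<le> 2 * (\<Sum>x\<in>A. card {y \<in> A. R y x})"
proof -
  define S where "S = (SIGMA x:A. {y \<in> A. R y x})"
  have finS: "finite S"
    unfolding S_def using fin by auto
  have "Id_on A = (\<lambda>x. (x, x)) ` A"
    by auto
  then have "finite (Id_on A)" "card (Id_on A) = card A"
    using fin by (simp_all add: card_image inj_on_def)
  moreover have "Id_on A \<subseteq> A \<times> A"
    by auto
  ultimately have "card (A \<times> A - Id_on A) = card A * card A - card A"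
    by (simp add: card_Diff_subset card_cartesian_product)
  then have "card A * (card A - 1) = card (A \<times> A - Id_on A)"
    by (simp add: diff_mult_distrib2)
  also have "\<dots> \<le> card (S \<union> S\<inverse>)"
    using tot finS by (intro card_mono) (auto simp: S_def totalp_on_def)
  also have "\<dots> \<le> card S + card (S\<inverse>)"
    by (rule card_Un_le)
  also have "\<dots> = 2 * card S"
    by (simp add: card_inverse)
  also have "card S = (\<Sum>x\<in>A. card {y \<in> A. R y x})"
    unfolding S_def using fin by (simp add: card_SigmaI)
  finally show ?thesis .
qed

section \<open>The first upper bound\<close>

lemma UB1_le_feasible_value:
  assumes "simple_graph G" "UB1_feasible G c \<C> \<pi> \<rho>"
  shows "UB1 G c \<C> \<le> (\<Sum>I\<in>\<C>. \<pi> I)"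
  unfolding UB1_def
  using assms(2) by (intro cInf_lower UB1_values_nonempty_bdd_below(2)[OF assms(1)]) blast

text \<open>The endpoints of an edge lie in different classes, and each class pays at least the share of
  the weight that is charged to its endpoint.\<close>

lemma edge_weight_le_UB1:
  assumes G: "simple_graph G" and col: "coloring G \<C>" and uv: "{u, v} \<in> edges G"
  shows "real (c {u, v}) \<le> UB1 G c \<C>"
  unfolding UB1_def
proof (rule cInf_greatest[OF UB1_values_nonempty_bdd_below(1)[OF G]])
  fix s assume "s \<in> {(\<Sum>I\<in>\<C>. \<pi> I) | \<pi> \<rho>. UB1_feasible G c \<C> \<pi> \<rho>}"
  then obtain \<pi> \<rho> where s: "s = (\<Sum>I\<in>\<C>. \<pi> I)" and feas: "UB1_feasible G c \<C> \<pi> \<rho>"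
    by blast
  have part: "partition_on (verts G) \<C>" and ind: "\<And>I. I \<in> \<C> \<Longrightarrow> independent_set G I"
    using col by (auto simp: coloring_def)
  have "finite \<C>"
    using G part by (auto simp: simple_graph_def intro: finite_elements)
  have "{u, v} \<subseteq> verts G"
    using G uv unfolding simple_graph_def by (metis empty_subsetI insert_subset)
  then have "u \<in> verts G" "v \<in> verts G"
    by simp_all
  then obtain I J where IJ: "I \<in> \<C>" "u \<in> I" "J \<in> \<C>" "v \<in> J"
    using partition_onD1[OF part] by auto
  have "I \<noteq> J"
    using IJ ind uv unfolding independent_set_def by blast
  have share: "\<rho> {u, v} w \<le> \<pi> K" if "w \<in> {u, v}" "K \<in> \<C>" "w \<in> K" for w K
  proof -
    have "\<rho> {u, v} w \<le> (\<Sum>e\<in>incident_edges G w. \<rho> e w)"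
      using that uv feas
      by (intro member_le_sum finite_incident_edges G)
        (auto simp: incident_edges_def UB1_feasible_def)
    also have "\<dots> \<le> \<pi> K"
      using that feas by (auto simp: UB1_feasible_def)
    finally show ?thesis .
  qed
  have "real (c {u, v}) = \<rho> {u, v} u + \<rho> {u, v} v"
    using feas uv by (simp add: UB1_feasible_def)
  also have "\<dots> \<le> \<pi> I + \<pi> J"
    using share IJ by (intro add_mono) auto
  also have "\<dots> = (\<Sum>K\<in>{I, J}. \<pi> K)"
    using \<open>I \<noteq> J\<close> by simp
  also have "\<dots> \<le> s"
    unfolding s using \<open>finite \<C>\<close> IJ feas
    by (intro sum_mono2) (auto simp: UB1_feasible_def)
  finally show "real (c {u, v}) \<le> s" .
qed

lemma card_coloring2_le:
  assumes "coloring2 n \<C>"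
  shows "card \<C> \<le> n"
  using assms card_image_le[of "{..<n}"] by (auto simp: coloring2_def)

lemma c2_Leaf:
  assumes "c2 n e \<noteq> 0" "Leaf i k \<in> e"
  shows "e = {Hub i, Leaf i k}"
  using assms by (auto simp: c2_def CL_def split: if_splits)

text \<open>Charging every weight to the leaf leaves the hubs without load, and a leaf carries only the
  weight of the edge to its own hub. So cost \<open>1\<close> for each class is feasible.\<close>

lemma UB1_le:
  assumes col: "coloring2 n \<C>"
  shows "UB1 (G2 n) (c2 n) \<C> \<le> real n"
proof -
  define \<rho> :: "vertex set \<Rightarrow> vertex \<Rightarrow> real" where
    "\<rho> e x = (case x of Hub _ \<Rightarrow> 0 | Leaf _ _ \<Rightarrow> real (c2 n e))" for e x
  have "\<rho> {u, v} u + \<rho> {u, v} v = real (c2 n {u, v})" if "{u, v} \<in> edges (G2 n)" for u v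
    \<comment> \<open>Two hubs or two leaves never carry weight; a hub and a leaf contribute \<open>0\<close> and the weight.\<close>
    by (cases u; cases v) (auto simp: \<rho>_def c2_def CL_def doubleton_eq_iff)
  moreover have "(\<Sum>e\<in>incident_edges (G2 n) u. \<rho> e u) \<le> 1" for u
  proof (cases u)
    case (Hub i)
    then show ?thesis by (simp add: \<rho>_def)
  next
    case (Leaf i k)
    have "(\<Sum>e\<in>incident_edges (G2 n) u. \<rho> e u)
        \<le> (\<Sum>e\<in>incident_edges (G2 n) u. if e = {Hub i, Leaf i k} then 1 else 0)"
    proof (intro sum_mono)
      fix e assume "e \<in> incident_edges (G2 n) u"
      then have "Leaf i k \<in> e"
        using Leaf by (simp add: incident_edges_def)
      moreover have "c2 n e \<le> 1"
        by (simp add: c2_def)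
      ultimately show "\<rho> e u \<le> (if e = {Hub i, Leaf i k} then 1 else 0)"
        using c2_Leaf[of n e i k] Leaf by (auto simp: \<rho>_def)
    qed
    also have "\<dots> \<le> 1"
      by (simp add: finite_incident_edges[OF simple_graph_G2] sum.delta)
    finally show ?thesis .
  qed
  ultimately have "UB1_feasible (G2 n) (c2 n) \<C> (\<lambda>_. 1) \<rho>"
    by (auto simp: UB1_feasible_def \<rho>_def split: vertex.split)
  from UB1_le_feasible_value[OF simple_graph_G2 this] card_coloring2_le[OF col]
  show ?thesis by simp
qed

lemma hub_leaf_edge:
  assumes "i < n" "v \<in> CL n i"
  shows "{Hub i, v} \<in> edges (G2 n)" "c2 n {Hub i, v} = 1"
  using assms by (auto simp: edge_G2_iff c2_def CL_def)

lemma UB1_ge_1: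
  assumes n: "n \<ge> 2" and col: "coloring2 n \<C>"
  shows "UB1 (G2 n) (c2 n) \<C> \<ge> 1"
proof -
  have "0 < n" "Leaf 0 0 \<in> CL n 0"
    using n by (auto simp: CL_def)
  note e = hub_leaf_edge[OF this]
  have "coloring (G2 n) \<C>"
    using col by (simp add: coloring2_def)
  from edge_weight_le_UB1[OF simple_graph_G2 this e(1), of "c2 n"] e(2) show ?thesis
    by simp
qed

section \<open>The second upper bound\<close>

text \<open>Each class \<open>J\<close> preceding that of the hub contributes exactly \<open>1\<close>: by irreflexivity \<open>J\<close> is the class
  of another hub, so it meets the leaves of \<open>Hub i\<close>, and the edge to such a leaf has the
  largest weight that occurs.\<close>

lemma sigma_hub:
  assumes col: "coloring2 n \<C>" and irr: "irreflp_on \<C> prec"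
    and I: "I \<in> \<C>" and hub: "Hub i \<in> I" and i: "i < n"
  shows "sigma (G2 n) (c2 n) \<C> prec (Hub i) = card {J \<in> \<C>. prec J I}"
proof -
  have col': "coloring (G2 n) \<C>"
    using col by (simp add: coloring2_def)
  have "Max (insert 0 {c2 n {Hub i, v} | v. {Hub i, v} \<in> incident_edges (G2 n) (Hub i) \<and> v \<in> J}) = 1"
    (is "Max (insert 0 ?W) = 1") if J: "J \<in> \<C>" "prec J I" for J
  proof -
    obtain cls where cls: "\<C> = cls ` {..<n}"
        "\<And>j. j < n \<Longrightarrow> cls j \<inter> C0 n = {Hub j}"
        "\<And>j k. j < n \<Longrightarrow> k < n \<Longrightarrow> k \<noteq> j \<Longrightarrow> card (cls j \<inter> CL n k) = 1"
      using col unfolding coloring2_def by metis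
    obtain j where j: "j < n" "J = cls j"
      using J(1) cls(1) by auto
    have "J \<noteq> I"
      using irr J I by (auto simp: irreflp_on_def)
    have "I = cls i"
      using color_of_eq[OF col' I hub] color_of_eq[OF col', of "cls i" "Hub i"] cls(1,2) i
      by blast
    then have "i \<noteq> j"
      using \<open>J \<noteq> I\<close> j by blast
    then have "card (J \<inter> CL n i) = 1"
      using cls(3) i j by blast
    then obtain v where "v \<in> J" "v \<in> CL n i"
      by (metis IntE card_1_singletonE insertI1)
    then have "1 \<in> ?W"
      using hub_leaf_edge[OF i, of v] by (force simp: incident_edges_def)
    moreover have "?W \<subseteq> {0, 1}"
      by (auto simp: c2_def)
    ultimately have "insert 0 ?W = {0, 1}"
      by (intro equalityI insert_subsetI insertI1 insertI2) simp_all
    then show ?thesis by simp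
  qed
  then show ?thesis
    unfolding sigma_def color_of_eq[OF col' I hub] by simp
qed

text \<open>Estimating the maximum over each class by the value at its hub leaves the number of pairs of
  classes in the order relation, which totality bounds from below.\<close>

lemma UB2_ge:
  assumes col: "coloring2 n \<C>" and ord: "strict_total_order_on \<C> prec"
  shows "n * (n - 1) \<le> 2 * UB2 (G2 n) (c2 n) \<C> prec"
proof -
  have irr: "irreflp_on \<C> prec" and tot: "totalp_on \<C> prec"
    using ord by (auto simp: strict_total_order_on_def)
  obtain cls where cls: "\<C> = cls ` {..<n}" "\<And>i. i < n \<Longrightarrow> cls i \<inter> C0 n = {Hub i}"
    using col unfolding coloring2_def by metis
  have "inj_on cls {..<n}"
    using cls(2) by (intro inj_onI) (metis lessThan_iff singleton_inject vertex.inject(1))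
  then have card: "card \<C> = n"
    by (simp add: cls(1) card_image)
  have "card {J \<in> \<C>. prec J I} \<le> Max (sigma (G2 n) (c2 n) \<C> prec ` I)" if I: "I \<in> \<C>" for I
  proof -
    obtain i where i: "i < n" "Hub i \<in> I"
      using I cls by blast
    have "I \<subseteq> verts (G2 n)"
      using col I by (auto simp: coloring2_def coloring_def independent_set_def)
    then have "finite I"
      using simple_graph_G2 finite_subset unfolding simple_graph_def by blast
    then show ?thesis
      using sigma_hub[OF col irr I i(2,1)] i(2) by (metis Max_ge finite_imageI imageI)
  qed
  then have "(\<Sum>I\<in>\<C>. card {J \<in> \<C>. prec J I}) \<le> UB2 (G2 n) (c2 n) \<C> prec"
    unfolding UB2_def by (rule sum_mono)
  moreover have "card \<C> * (card \<C> - 1) \<le> 2 * (\<Sum>I\<in>\<C>. card {J \<in> \<C>. prec J I})"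
    using tot cls(1) by (intro totalp_on_sum_card_predecessors_ge) auto
  ultimately show ?thesis
    unfolding card by linarith
qed

section \<open>The quotient of the two bounds\<close>

theorem proposition3:
  fixes \<C> :: "nat \<Rightarrow> vertex set set"
    and prec :: "nat \<Rightarrow> vertex set \<Rightarrow> vertex set \<Rightarrow> bool"
  assumes "\<And>n. n \<ge> 2 \<Longrightarrow> coloring2 n (\<C> n)"
    and "\<And>n. n \<ge> 2 \<Longrightarrow> strict_total_order_on (\<C> n) (prec n)"
  shows "filterlim (\<lambda>n. real (UB2 (G2 n) (c2 n) (\<C> n) (prec n)) / UB1 (G2 n) (c2 n) (\<C> n))
           at_top sequentially"
proof (rule filterlim_at_top_mono)
  show "filterlim (\<lambda>n. (1 / 2) * (- 1 + real n)) at_top sequentially"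
    by (intro filterlim_tendsto_pos_mult_at_top[OF tendsto_const]
          filterlim_tendsto_add_at_top[OF tendsto_const] filterlim_real_sequentially) simp
  show "\<forall>\<^sub>F n in sequentially. (1 / 2) * (- 1 + real n)
      \<le> real (UB2 (G2 n) (c2 n) (\<C> n) (prec n)) / UB1 (G2 n) (c2 n) (\<C> n)"
    using eventually_ge_at_top[of 2]
  proof eventually_elim
    case (elim n)
    let ?U1 = "UB1 (G2 n) (c2 n) (\<C> n)" and ?U2 = "UB2 (G2 n) (c2 n) (\<C> n) (prec n)"
    have pos: "0 < ?U1"
      using UB1_ge_1[OF elim assms(1)[OF elim]] by linarith
    have "(1 / 2) * (- 1 + real n) * ?U1 \<le> (1 / 2) * (- 1 + real n) * real n"
      using elim UB1_le[OF assms(1)[OF elim]] by (intro mult_left_mono) auto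
    also have "\<dots> = real (n * (n - 1)) / 2"
      using elim by (simp add: of_nat_diff algebra_simps)
    also have "\<dots> \<le> real ?U2"
      using UB2_ge[OF assms(1)[OF elim] assms(2)[OF elim]] by linarith
    finally show ?case
      using pos by (simp add: pos_le_divide_eq)
  qed
qed

end
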